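(* Let $N\ge3$ be an integer and $\hat\rho,\hat\rho_1\in[0,1]$. Let $p_{\rm eq}\in[0,1]$ be the solution of $K(p_{\rm eq},N)=\hat\rho$ if $\hat\rho\in[\frac1N,1-\frac1N]$, $p_{\rm eq}=0$ if $\hat\rho<\frac1N$, and $p_{\rm eq}=1$ if $\hat\rho>1-\frac1N$. Consider player 1's utility $q_1\mapsto \mathcal U_1((q_1,p_{\rm eq},\dots,p_{\rm eq}),\hat\rho_1)$ on $[0,1]$. Its set of maximizers is $\{1\}$ if $\hat\rho_1>K(p_{\rm eq},N)$, $\{0\}$ if $\hat\rho_1<K(p_{\rm eq},N)$, and $[0,1]$ if $\hat\rho_1=K(p_{\rm eq},N)$. Consequently $$(q_1)^{\rm pre}_{\rm eq}=\begin{cases}\mathbf 1[\hat\rho_1>\hat\rho] & \text{if }\hat\rho_1\in[1/N,1-1/N],\\ 0&\text{if }\hat\rho_1<1/N,\\ 1&\text{if }\hat\rho_1>1-1/N\end{cases}$$ is a best response of player 1 (a maximizer of this function).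
   Context: Game: there are $N\ge3$ players. Each player $j$ bets $a_j\in\{0,1\}$ (1 = Heads, 0 = Tails) on an outcome $w\in\{0,1\}$. The payoff of player $i$ is $u_i(\vec a\mid w)=0$ if no $j$ has $a_j=w$, and otherwise $u_i(\vec a\mid w)=N\,\dfrac{\delta_{w,a_i}}{\sum_j\delta_{w,a_j}}-1$, with $\delta$ the Kronecker delta. A strategy $p_j\in[0,1]$ is the probability that player $j$ bets 1; bets are independent across players. Given a strategy profile $\vec p=(p_1,\dots,p_N)$ and a belief $r\in[0,1]$, $$\mathcal U_i(\vec p,r)=r\,\mathbb E_{\vec a}[u_i(\vec a\mid 1)]+(1-r)\,\mathbb E_{\vec a}[u_i(\vec a\mid 0)],$$ where under $\mathbb E_{\vec a}$ the $a_j$ are independent Bernoulli($p_j$). $K(p,N)=\dfrac{p-p^N}{1-p^N-(1-p)^N}$ for $p\in(0,1)$, extended by its limits $K(0,N)=\frac1N$, $K(1,N)=1-\frac1N$; for fixed $N\ge 3$ it is a strictly increasing bijection of $[0,1]$ onto $[\frac1N,1-\frac1N]$. $\mathbf 1[\cdot]$ is the indicator (1 if true, 0 if false). Interpretation: $\hat\rho$ is the belief of players $2,\dots,N$, $\hat\rho_1$ that of the better-informed player 1. *)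

theory Defs
  imports "HOL-Probability.Probability" "HOL-Probability.Product_PMF"
begin

text \<open>Players are \<open>1, \<dots>, N\<close>. Bets and outcomes are Booleans, with \<open>True\<close> for Heads (1)
  and \<open>False\<close> for Tails (0).\<close>

definition payoff :: "nat \<Rightarrow> nat \<Rightarrow> (nat \<Rightarrow> bool) \<Rightarrow> bool \<Rightarrow> real" where
  "payoff N i a w =
     (if \<not> (\<exists>j\<in>{1..N}. a j = w) then 0
      else real N * (of_bool (a i = w) / (\<Sum>j=1..N. of_bool (a j = w))) - 1)"

definition bets_pmf :: "nat \<Rightarrow> (nat \<Rightarrow> real) \<Rightarrow> (nat \<Rightarrow> bool) pmf" where
  "bets_pmf N p = Pi_pmf {1..N} False (\<lambda>j. bernoulli_pmf (p j))"

definition utility :: "nat \<Rightarrow> nat \<Rightarrow> (nat \<Rightarrow> real) \<Rightarrow> real \<Rightarrow> real" where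
  "utility N i p r =
     r * measure_pmf.expectation (bets_pmf N p) (\<lambda>a. payoff N i a True)
     + (1 - r) * measure_pmf.expectation (bets_pmf N p) (\<lambda>a. payoff N i a False)"

definition player1_utility :: "nat \<Rightarrow> real \<Rightarrow> real \<Rightarrow> real \<Rightarrow> real" where
  "player1_utility N p r q = utility N 1 (\<lambda>j. if j = 1 then q else p) r"

text \<open>The values at 0 and 1 are the limits of the generic expression; see
  \<open>K_continuous_on\<close> below. Only arguments in \<open>{0..1}\<close> are meaningful.\<close>

definition K :: "real \<Rightarrow> nat \<Rightarrow> real" where
  "K p N =
     (if p = 0 then 1 / real N
      else if p = 1 then 1 - 1 / real N
      else (p - p ^ N) / (1 - p ^ N - (1 - p) ^ N))"

definition is_p_eq :: "nat \<Rightarrow> real \<Rightarrow> real \<Rightarrow> bool" where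
  "is_p_eq N \<rho> p \<longleftrightarrow>
     p \<in> {0..1} \<and>
     (if \<rho> < 1 / real N then p = 0
      else if \<rho> > 1 - 1 / real N then p = 1
      else K p N = \<rho>)"

definition q1_pre :: "nat \<Rightarrow> real \<Rightarrow> real \<Rightarrow> real" where
  "q1_pre N \<rho> \<rho>1 =
     (if \<rho>1 < 1 / real N then 0
      else if \<rho>1 > 1 - 1 / real N then 1
      else of_bool (\<rho>1 > \<rho>))"

text \<open>The remaining facts show that \<open>K\<close> is the continuous extension of the generic expression
  and that the number described by \<open>is_p_eq\<close> exists and is unique.\<close>

lemma K_eq_quotient:
  assumes "N \<ge> 3" "p \<in> {0..1}"
  shows "K p N = (\<Sum>k<N-1. p ^ k) / ((\<Sum>k<N-1. p ^ k) + (\<Sum>k<N-1. (1 - p) ^ k))"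
proof -
  have fac: "x - x ^ N = x * (1 - x) * (\<Sum>k<N-1. x ^ k)" for x :: real
  proof -
    have "x ^ N = x * x ^ (N - 1)"
      using assms(1) by (simp flip: power_Suc)
    then have "x - x ^ N = x * (1 - x ^ (N - 1))"
      by (simp add: right_diff_distrib)
    also have "1 - x ^ (N - 1) = (1 - x) * (\<Sum>k<N-1. x ^ k)"
      by (rule one_diff_power_eq)
    finally show ?thesis
      by (simp only: mult.assoc)
  qed
  have at0: "(\<Sum>k<N - Suc 0. (0::real) ^ k) = 1"
    using assms(1) by (simp add: power_0_left sum.delta)
  consider "p = 0" | "p = 1" | "0 < p" "p < 1"
    using assms(2) by fastforce
  then show ?thesis
  proof cases
    case 1
    then show ?thesis using assms(1) by (simp add: K_def at0 of_nat_diff)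
  next
    case 2
    then show ?thesis using assms(1) by (simp add: K_def at0 of_nat_diff field_simps)
  next
    case 3
    have "1 - p ^ N - (1 - p) ^ N = (p - p ^ N) + ((1 - p) - (1 - p) ^ N)"
      by simp
    also have "\<dots> = p * (1 - p) * ((\<Sum>k<N-1. p ^ k) + (\<Sum>k<N-1. (1 - p) ^ k))"
      by (simp only: fac) (simp add: algebra_simps)
    finally show ?thesis
      using 3 by (simp add: K_def fac)
  qed
qed

lemma geometric_sum_strict_mono:
  fixes x y :: real
  assumes "N \<ge> 3" "0 \<le> x" "x < y"
  shows "(\<Sum>k<N-1. x ^ k) < (\<Sum>k<N-1. y ^ k)"
proof (rule sum_strict_mono_ex1)
  show "\<forall>k\<in>{..<N-1}. x ^ k \<le> y ^ k"
    using assms by (simp add: power_mono)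
  show "\<exists>k\<in>{..<N-1}. x ^ k < y ^ k"
    using assms by (intro bexI[of _ 1]) auto
qed simp

lemma geometric_sum_pos:
  fixes x :: real
  assumes "N \<ge> 3" "0 \<le> x"
  shows "(\<Sum>k<N-1. x ^ k) > 0"
  using assms by (intro sum_pos2[of _ 0]) auto

lemma K_continuous_on:
  assumes "N \<ge> 3"
  shows "continuous_on {0..1} (\<lambda>p. K p N)"
proof -
  have "(\<Sum>k<N-1. p ^ k) + (\<Sum>k<N-1. (1 - p) ^ k) \<noteq> 0" if "p \<in> {0..1}" for p :: real
    using geometric_sum_pos[OF assms, of p] geometric_sum_pos[OF assms, of "1 - p"] that
    by simp
  then have "continuous_on {0..1}
    (\<lambda>p::real. (\<Sum>k<N-1. p ^ k) / ((\<Sum>k<N-1. p ^ k) + (\<Sum>k<N-1. (1 - p) ^ k)))"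
    by (intro continuous_intros) blast
  then show ?thesis
    by (rule continuous_on_eq) (simp only: K_eq_quotient[OF assms])
qed

lemma K_strict_mono_on:
  assumes "N \<ge> 3"
  shows "strict_mono_on {0..1} (\<lambda>p. K p N)"
proof (rule strict_mono_onI)
  fix x y :: real
  assume xy: "x \<in> {0..1}" "y \<in> {0..1}" "x < y"
  define S where "S z = (\<Sum>k<N-1. z ^ k)" for z :: real
  have pos: "S x > 0" "S y > 0" "S (1 - x) > 0" "S (1 - y) > 0"
    using xy geometric_sum_pos[OF assms] by (auto simp: S_def)
  have "S x < S y" "S (1 - y) < S (1 - x)"
    using xy geometric_sum_strict_mono[OF assms] by (auto simp: S_def)
  then have "S x * S (1 - y) < S y * S (1 - x)"
    using pos by (intro mult_strict_mono) auto
  then have "S x / (S x + S (1 - x)) < S y / (S y + S (1 - y))"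
    using pos by (simp add: divide_simps add_pos_pos algebra_simps)
  then show "K x N < K y N"
    using xy by (simp add: K_eq_quotient[OF assms] S_def)
qed

lemma ex1_is_p_eq:
  assumes "N \<ge> 3"
  shows "\<exists>!p. is_p_eq N \<rho> p"
proof (cases "\<rho> < 1 / real N \<or> \<rho> > 1 - 1 / real N")
  case True
  have "1 / real N \<le> 1 - 1 / real N"
    using assms by (simp add: field_simps)
  then have "is_p_eq N \<rho> p \<longleftrightarrow> p = (if \<rho> < 1 / real N then 0 else 1)" for p
    using True by (auto simp: is_p_eq_def)
  then show ?thesis by simp
next
  case False
  then have "\<exists>p\<ge>0. p \<le> 1 \<and> K p N = \<rho>"
    using K_continuous_on[OF assms] by (intro IVT') (auto simp: K_def)
  moreover have "inj_on (\<lambda>p. K p N) {0..1}"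
    using K_strict_mono_on[OF assms] by (rule strict_mono_on_imp_inj_on)
  ultimately show ?thesis
    using False by (auto simp: is_p_eq_def inj_on_def)
qed

end

theory Submission
  imports Defs
begin

text \<open>Player 1's utility is affine in \<open>q\<^sub>1\<close>. With \<open>S x = (\<Sum>k<N-1. x ^ k)\<close>, the expected gain from
  betting on \<open>w\<close> rather than on the other side, given the outcome \<open>w\<close>, is
  \<open>S (1 - p)\<close> for Heads and \<open>S p\<close> for Tails, where \<open>p\<close> is the common strategy of the others. The
  slope is therefore \<open>r * S (1 - p) - (1 - r) * S p = (S p + S (1 - p)) * (r - K p N)\<close>, and its
  sign decides which \<open>q\<^sub>1\<close> is optimal.\<close>

lemma map_eq_bernoulli_pmf:
  assumes "p \<in> {0..1}"
  shows "map_pmf (\<lambda>b. b = w) (bernoulli_pmf p) = bernoulli_pmf (if w then p else 1 - p)"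
proof (cases w)
  case True
  then show ?thesis by simp
next
  case False
  have "map_pmf Not (bernoulli_pmf p) = bernoulli_pmf (1 - p)"
  proof (rule pmf_eqI)
    fix b
    \<comment> \<open>Writing the point as \<open>\<not> \<not> b\<close> exhibits it as the image
      of \<open>\<not> b\<close> under the injection \<open>Not\<close>.\<close>
    have "pmf (map_pmf Not (bernoulli_pmf p)) (\<not> \<not> b) = pmf (bernoulli_pmf p) (\<not> b)"
      by (rule pmf_map_inj') (auto intro: injI)
    then show "pmf (map_pmf Not (bernoulli_pmf p)) b = pmf (bernoulli_pmf (1 - p)) b"
      using assms by (cases b) auto
  qed
  then show ?thesis using False by simp
qed

lemma map_card_eq_Pi_pmf_bernoulli:
  assumes "finite A" "p \<in> {0..1}"
  shows "map_pmf (\<lambda>f. card {j\<in>A. f j = w}) (Pi_pmf A d (\<lambda>_. bernoulli_pmf p)) =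
           binomial_pmf (card A) (if w then p else 1 - p)"
proof -
  have "binomial_pmf (card A) (if w then p else 1 - p) =
      map_pmf (\<lambda>f. card {j\<in>A. f j})
        (Pi_pmf A (d = w) (\<lambda>_. bernoulli_pmf (if w then p else 1 - p)))"
    using assms by (intro binomial_pmf_altdef') auto
  \<comment> \<open>Comparison with \<open>w\<close> acts on the default as well, so the product on
    the left must carry the default \<open>d = w\<close>.\<close>
  also have "Pi_pmf A (d = w) (\<lambda>_. bernoulli_pmf (if w then p else 1 - p)) =
      map_pmf (\<lambda>f. (\<lambda>b. b = w) \<circ> f) (Pi_pmf A d (\<lambda>_. bernoulli_pmf p))"
    unfolding map_eq_bernoulli_pmf[OF assms(2), symmetric] using assms(1)
    by (rule Pi_pmf_map) simp
  finally show ?thesis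
    by (simp add: pmf.map_comp o_def)
qed

text \<open>If \<open>m\<close> of \<open>n\<close> opponents bet on the outcome, joining them pays
  \<open>(n+1)/(m+1) - 1\<close>, and opposing them pays -1, or 0 when \<open>m = 0\<close>; the
  integrand is the difference. Absorbing the quotient into the binomial coefficient gives a
  geometric sum of \<open>n+1\<close> terms, and the event \<open>m = 0\<close> removes the last
  one, \<open>(1 - p) ^ n\<close>.\<close>

lemma expectation_binomial_gain:
  fixes p :: real
  assumes "p \<in> {0..1}"
  shows "measure_pmf.expectation (binomial_pmf n p) (\<lambda>m. real (Suc n) / real (Suc m) - of_bool (m = 0))
           = (\<Sum>k<n. (1 - p) ^ k)"
proof -
  have choose: "real (n choose m) * (real (Suc n) / real (Suc m)) = real (Suc n choose Suc m)" for m
  proof -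
    have "real (Suc m) * real (Suc n choose Suc m) = real (Suc n) * real (n choose m)"
      using Suc_times_binomial_eq[of n m] by (metis of_nat_mult mult.commute)
    then show ?thesis by (simp add: field_simps del: binomial_Suc_Suc of_nat_Suc)
  qed
  have "(\<Sum>m\<le>n. real (n choose m) * p ^ m * (1 - p) ^ (n - m) * (real (Suc n) / real (Suc m)))
      = (\<Sum>m\<le>n. real (Suc n choose Suc m) * p ^ m * (1 - p) ^ (n - m))"
    by (intro sum.cong refl) (simp add: mult_ac del: binomial_Suc_Suc of_nat_Suc flip: choose)
  also have "\<dots> = (\<Sum>k<Suc n. (1 - p) ^ k)"
  proof (cases "p = 0")
    case True
    then show ?thesis by (simp add: power_0_left if_distribR if_distrib[of "\<lambda>x. _ * x"] cong: if_cong)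
  next
    case False
    \<comment> \<open>The factor \<open>p\<close>, which forces the separate case
      \<open>p = 0\<close>, shifts the index and turns the sum into the binomial expansion of
      exponent \<open>n+1\<close> without its term at 0.\<close>
    have "p * (\<Sum>m\<le>n. real (Suc n choose Suc m) * p ^ m * (1 - p) ^ (n - m)) =
        (\<Sum>m\<le>Suc n. real (Suc n choose m) * p ^ m * (1 - p) ^ (Suc n - m)) - (1 - p) ^ Suc n"
      by (subst sum.atMost_Suc_shift)
        (simp add: sum_distrib_left mult_ac del: binomial_Suc_Suc sum.atMost_Suc)
    also have "(\<Sum>m\<le>Suc n. real (Suc n choose m) * p ^ m * (1 - p) ^ (Suc n - m)) = (p + (1 - p)) ^ Suc n"
      by (rule binomial_ring[symmetric])
    also have "(p + (1 - p)) ^ Suc n - (1 - p) ^ Suc n = p * (\<Sum>k<Suc n. (1 - p) ^ k)"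
      using one_diff_power_eq[of "1 - p" "Suc n"] by simp
    finally show ?thesis
      using False by (simp only: mult_cancel_left) simp
  qed
  finally have "(\<Sum>m\<le>n. real (n choose m) * p ^ m * (1 - p) ^ (n - m) * (real (Suc n) / real (Suc m)))
      = (\<Sum>k<n. (1 - p) ^ k) + (1 - p) ^ n"
    by simp
  moreover have "(\<Sum>m\<le>n. real (n choose m) * p ^ m * (1 - p) ^ (n - m) * of_bool (m = 0)) = (1 - p) ^ n"
    by (simp add: of_bool_def if_distrib cong: if_cong)
  ultimately show ?thesis
    using assms by (simp add: expectation_binomial_pmf' right_diff_distrib sum_subtractf)
qed

text \<open>The opponents' bets enter only through the number of them on \<open>w\<close>, which
  reduces the later expectations to binomial ones. A losing bet costs 1 unless nobody bet on
  \<open>w\<close>.\<close>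

lemma payoff_player1:
  assumes "N \<ge> 1"
  shows "payoff N 1 (f(1 := b)) w =
           (if b = w then real N / real (Suc (card {j\<in>{2..N}. f j = w})) - 1
            else of_bool (card {j\<in>{2..N}. f j = w} = 0) - 1)"
proof -
  have split: "{1..N} = insert 1 {2..N}"
    using assms by auto
  have count: "(\<Sum>j\<in>{2..N}. of_bool ((f(1 := b)) j = w)) = real (card {j\<in>{2..N}. f j = w})"
  proof -
    have "(\<Sum>j\<in>{2..N}. of_bool ((f(1 := b)) j = w) :: real) = (\<Sum>j\<in>{2..N}. of_bool (f j = w))"
      by (intro sum.cong) auto
    also have "\<dots> = real (card {j\<in>{2..N}. f j = w})"
      by (simp add: of_bool_def sum.If_cases Int_def)
    finally show ?thesis .
  qed
  have "(\<Sum>j=1..N. of_bool ((f(1 := b)) j = w)) = of_bool (b = w) + real (card {j\<in>{2..N}. f j = w})"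
    unfolding split using count by (subst sum.insert) (auto simp del: fun_upd_apply simp: fun_upd_same)
  moreover have "(\<exists>j\<in>{1..N}. (f(1 := b)) j = w) \<longleftrightarrow> b = w \<or> card {j\<in>{2..N}. f j = w} \<noteq> 0"
    unfolding split by auto
  ultimately show ?thesis
    unfolding payoff_def by (simp only:) auto
qed

lemma finite_set_Pi_pmf_bernoulli:
  assumes "finite A"
  shows "finite (set_pmf (Pi_pmf A d (\<lambda>j. bernoulli_pmf (p j))))"
  unfolding set_Pi_pmf[OF assms] using assms by (rule finite_PiE_dflt) (rule finite)

text \<open>Independence allows conditioning on player 1's own bet, which makes the dependence on
  \<open>q\<close> explicit.\<close>

lemma expectation_bets_player1:
  fixes h :: "(nat \<Rightarrow> bool) \<Rightarrow> real"
  assumes "N \<ge> 1" "q \<in> {0..1}"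
  shows "measure_pmf.expectation (bets_pmf N (\<lambda>j. if j = 1 then q else p)) h =
     q * measure_pmf.expectation (Pi_pmf {2..N} False (\<lambda>_. bernoulli_pmf p)) (\<lambda>f. h (f(1 := True)))
     + (1 - q) * measure_pmf.expectation (Pi_pmf {2..N} False (\<lambda>_. bernoulli_pmf p)) (\<lambda>f. h (f(1 := False)))"
proof -
  let ?P = "Pi_pmf {2..N} False (\<lambda>_. bernoulli_pmf p)"
  have split: "{1..N} = insert 1 {2..N}"
    using assms by auto
  have others: "Pi_pmf {2..N} False (\<lambda>j. bernoulli_pmf (if j = 1 then q else p)) = ?P"
    by (intro Pi_pmf_cong) auto
  have fin: "finite (set_pmf ?P)"
    by (rule finite_set_Pi_pmf_bernoulli) simp
  have "bets_pmf N (\<lambda>j. if j = 1 then q else p) =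
      bernoulli_pmf q \<bind> (\<lambda>b. map_pmf (\<lambda>f. f(1 := b)) ?P)"
    unfolding bets_pmf_def split
    by (subst Pi_pmf_insert') (auto simp: others[unfolded One_nat_def] map_pmf_def)
  also have "measure_pmf.expectation \<dots> h =
      (\<Sum>b\<in>UNIV. pmf (bernoulli_pmf q) b *\<^sub>R measure_pmf.expectation (map_pmf (\<lambda>f. f(1 := b)) ?P) h)"
    using fin by (intro pmf_expectation_bind) auto
  finally show ?thesis
    using assms(2) by (simp add: UNIV_bool del: fun_upd_apply)
qed

text \<open>The constant is left unspecified because the maximizers depend only on the
  slope.\<close>

lemma player1_utility_affine:
  assumes "N \<ge> 1" "p \<in> {0..1}"
  obtains c where "\<And>q. q \<in> {0..1} \<Longrightarrow> player1_utility N p r q =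
     c + q * (r * (\<Sum>k<N-1. (1 - p) ^ k) - (1 - r) * (\<Sum>k<N-1. p ^ k))"
proof -
  define P where "P = Pi_pmf {2..N} False (\<lambda>_. bernoulli_pmf p)"
  define E where "E b w = measure_pmf.expectation P (\<lambda>f. payoff N 1 (f(1 := b)) w)" for b w
  have fin: "finite (set_pmf P)"
    unfolding P_def by (rule finite_set_Pi_pmf_bernoulli) simp
  \<comment> \<open>The base of the powers is the probability that a single opponent bets against
    \<open>w\<close>.\<close>
  have gain: "E w w - E (\<not> w) w = (\<Sum>k<N-1. (1 - (if w then p else 1 - p)) ^ k)" for w
  proof -
    have "E w w - E (\<not> w) w =
        measure_pmf.expectation P (\<lambda>f. payoff N 1 (f(1 := w)) w - payoff N 1 (f(1 := (\<not> w))) w)"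
      unfolding E_def using fin
      by (intro Bochner_Integration.integral_diff[symmetric] integrable_measure_pmf_finite)
    also have "\<dots> = measure_pmf.expectation (map_pmf (\<lambda>f. card {j\<in>{2..N}. f j = w}) P)
        (\<lambda>m. real (Suc (N - 1)) / real (Suc m) - of_bool (m = 0))"
      using assms(1) by (simp add: payoff_player1[OF assms(1), unfolded One_nat_def] del: of_nat_Suc)
    also have "\<dots> = (\<Sum>k<N-1. (1 - (if w then p else 1 - p)) ^ k)"
      unfolding P_def using assms
      by (subst map_card_eq_Pi_pmf_bernoulli)
        (use expectation_binomial_gain[of "if w then p else 1 - p" "N - 1"] in auto)
    finally show ?thesis .
  qed
  \<comment> \<open>The constant is the utility of a sure bet on Tails. Raising \<open>q\<close>
    moves away from the winning side when the outcome is Tails, hence the minus sign.\<close>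
  have "player1_utility N p r q = r * E False True + (1 - r) * E False False +
      q * (r * (\<Sum>k<N-1. (1 - p) ^ k) - (1 - r) * (\<Sum>k<N-1. p ^ k))" if "q \<in> {0..1}" for q
  proof -
    have "player1_utility N p r q =
        r * (q * E True True + (1 - q) * E False True)
        + (1 - r) * (q * E True False + (1 - q) * E False False)"
      unfolding player1_utility_def utility_def E_def P_def
      by (simp only: expectation_bets_player1[OF assms(1) that])
    also have "\<dots> = r * E False True + (1 - r) * E False False +
        q * (r * (E True True - E False True) - (1 - r) * (E False False - E True False))"
      by (simp add: algebra_simps)
    finally show ?thesis
      using gain[of True] gain[of False] by simp
  qed
  then show ?thesis by (rule that)
qed

lemma arg_max_affine_unit_interval:
  fixes u :: "real \<Rightarrow> real"
  assumes u: "\<And>q. q \<in> {0..1} \<Longrightarrow> u q = c + q * D"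
  shows "{q. is_arg_max u (\<lambda>q. q \<in> {0..1}) q} =
           (if D > 0 then {1} else if D < 0 then {0} else {0..1})"
proof -
  have "is_arg_max u (\<lambda>q. q \<in> {0..1}) q \<longleftrightarrow> q \<in> {0..1} \<and> (\<forall>y\<in>{0..1}. y * D \<le> q * D)" for q
    using u by (auto simp: is_arg_max_linorder)
  \<comment> \<open>An affine function on the interval is bounded by its larger endpoint value, so
    comparison with 0 and 1 suffices.\<close>
  moreover have "(\<forall>y\<in>{0..1}. y * D \<le> q * D) \<longleftrightarrow> D \<le> q * D \<and> 0 \<le> q * D" if "q \<in> {0..1}" for q
  proof
    assume *: "\<forall>y\<in>{0..1}. y * D \<le> q * D"
    show "D \<le> q * D \<and> 0 \<le> q * D"
      using *[rule_format, of 0] *[rule_format, of 1] by simp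
  next
    assume *: "D \<le> q * D \<and> 0 \<le> q * D"
    show "\<forall>y\<in>{0..1}. y * D \<le> q * D"
    proof
      fix y :: real
      assume "y \<in> {0..1}"
      then have "y * D \<le> max 0 D"
        by (cases "D \<ge> 0") (auto simp: mult_left_le_one_le mult_nonneg_nonpos)
      then show "y * D \<le> q * D"
        using * by linarith
    qed
  qed
  ultimately have "{q. is_arg_max u (\<lambda>q. q \<in> {0..1}) q} = {q\<in>{0..1}. D \<le> q * D \<and> 0 \<le> q * D}"
    by blast
  also have "\<dots> = (if D > 0 then {1} else if D < 0 then {0} else {0..1})"
    by (auto simp: mult_le_cancel_right1 mult_le_cancel_right2 zero_le_mult_iff)
  finally show ?thesis .
qed

text \<open>The boundary strategies 0 and 1 give the end values of \<open>K\<close>, so the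
  threshold is \<open>\<rho>\<close> clipped to the range of \<open>K\<close>. This links
  \<open>q1_pre\<close>, phrased through \<open>\<rho>\<close>, to the threshold.\<close>

lemma K_is_p_eq:
  assumes "is_p_eq N \<rho> p"
  shows "K p N = (if \<rho> < 1 / real N then 1 / real N
                  else if \<rho> > 1 - 1 / real N then 1 - 1 / real N else \<rho>)"
  using assms by (auto simp: is_p_eq_def K_def split: if_splits)

theorem mainTheorem2:
  fixes N :: nat and \<rho> \<rho>1 p_eq :: real
  assumes "N \<ge> 3" and "\<rho> \<in> {0..1}" and "\<rho>1 \<in> {0..1}"
    and "is_p_eq N \<rho> p_eq"
  shows "{q. is_arg_max (player1_utility N p_eq \<rho>1) (\<lambda>q. q \<in> {0..1}) q} =
           (if \<rho>1 > K p_eq N then {1}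
            else if \<rho>1 < K p_eq N then {0}
            else {0..1})
         \<and> is_arg_max (player1_utility N p_eq \<rho>1) (\<lambda>q. q \<in> {0..1}) (q1_pre N \<rho> \<rho>1)"
proof -
  have p: "p_eq \<in> {0..1}"
    using assms(4) by (simp add: is_p_eq_def)
  define S where "S x = (\<Sum>k<N-1. x ^ k)" for x :: real
  have pos: "S p_eq + S (1 - p_eq) > 0"
    unfolding S_def using p by (intro add_pos_pos geometric_sum_pos assms(1)) auto
  have K: "K p_eq N = S p_eq / (S p_eq + S (1 - p_eq))"
    unfolding S_def by (rule K_eq_quotient[OF assms(1) p])
  have slope: "\<rho>1 * S (1 - p_eq) - (1 - \<rho>1) * S p_eq = (S p_eq + S (1 - p_eq)) * (\<rho>1 - K p_eq N)"
    unfolding K using pos by (simp add: field_simps)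
  have "N \<ge> 1"
    using assms(1) by simp
  then obtain c where "\<And>q. q \<in> {0..1} \<Longrightarrow> player1_utility N p_eq \<rho>1 q =
      c + q * (\<rho>1 * S (1 - p_eq) - (1 - \<rho>1) * S p_eq)"
    unfolding S_def using player1_utility_affine[OF _ p, of N \<rho>1] by metis
  from arg_max_affine_unit_interval[OF this[unfolded slope]]
  have max: "{q. is_arg_max (player1_utility N p_eq \<rho>1) (\<lambda>q. q \<in> {0..1}) q} =
      (if \<rho>1 > K p_eq N then {1} else if \<rho>1 < K p_eq N then {0} else {0..1})"
    using pos by (simp add: zero_less_mult_iff mult_less_0_iff)
  have "1 / real N \<le> 1 - 1 / real N"
    using assms(1) by (simp add: field_simps)
  \<comment> \<open>For \<open>\<rho>1\<close> in the range of \<open>K\<close>, clipping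
    \<open>\<rho>\<close> can only turn a strict comparison into a tie, where every bet is optimal.
    Outside the range, \<open>\<rho>1\<close> lies strictly on one side of the threshold.\<close>
  then have "q1_pre N \<rho> \<rho>1 \<in>
      (if \<rho>1 > K p_eq N then {1} else if \<rho>1 < K p_eq N then {0} else {0..1})"
    by (auto simp: q1_pre_def K_is_p_eq[OF assms(4)])
  then show ?thesis
    unfolding max[symmetric] using max by simp
qed

end
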